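(* Let $\mathbb D\in\{\mathbb R,\mathbb C,\mathbb H\}$, let $A\in M_2(\mathbb D)$ be a nonzero non-invertible matrix, and let $k$ be a positive integer. Let $\phi_{A,k}:M_2(\mathbb D)\to M_2(\mathbb D)$ be the map $X\mapsto AX^k$. Then $$\operatorname{Im}(\phi_{A,k})=\{\,M\in M_2(\mathbb D)\setminus \mathrm{GL}_2(\mathbb D) : \rho(M)=\rho(A)\,\}\cup\{\theta\},$$ where $\theta$ is the zero matrix in $M_2(\mathbb D)$ and $\rho$ denotes the row dependency ratio.
   Context: $\mathbb H$ denotes Hamilton's real quaternion division algebra. For $\mathbb D\in\{\mathbb R,\mathbb C,\mathbb H\}$, every nonzero non-invertible matrix $A\in M_2(\mathbb D)$ has one of the two forms $$A=\begin{pmatrix} a_1 & a_2\\ ta_1 & ta_2\end{pmatrix}\quad\text{(first form)}\qquad\text{or}\qquad A=\begin{pmatrix}0&0\\ a_1&a_2\end{pmatrix}\quad\text{(second form)},$$ where $a_1,a_2\in\mathbb D$ are not both zero and $t\in\mathbb D$ (note that $t$ multiplies on the left). The row dependency ratio of such an $A$ is the element $\rho(A)\in\mathbb D\cup\{\infty\}$ defined by $\rho(A)=t$ if $A$ has the first form and $\rho(A)=\infty$ if $A$ has the second form (zero first row). The ratio $\rho(M)$ is defined only for nonzero non-invertible $M$, so the condition $\rho(M)=\rho(A)$ implicitly requires $M$ to be nonzero. *)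

theory Defs
  imports "HOL-Analysis.Analysis"
begin

section \<open>Hamilton's quaternions\<close>

text \<open>\<^term>\<open>Quat a b c d\<close> stands for $a + bi + cj + dk$, where $i^2 = j^2 = k^2 = ijk = -1$.\<close>

codatatype quat = Quat (QRe: real) (QI: real) (QJ: real) (QK: real)

lemma quat_eq_iff: "x = y \<longleftrightarrow> QRe x = QRe y \<and> QI x = QI y \<and> QJ x = QJ y \<and> QK x = QK y"
  by (auto intro: quat.expand)

instantiation quat :: ab_group_add
begin

primcorec zero_quat where
  "QRe 0 = 0" | "QI 0 = 0" | "QJ 0 = 0" | "QK 0 = 0"

primcorec plus_quat where
  "QRe (x + y) = QRe x + QRe y"
| "QI (x + y) = QI x + QI y"
| "QJ (x + y) = QJ x + QJ y"
| "QK (x + y) = QK x + QK y"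

primcorec uminus_quat where
  "QRe (- x) = - QRe x" | "QI (- x) = - QI x" | "QJ (- x) = - QJ x" | "QK (- x) = - QK x"

primcorec minus_quat where
  "QRe (x - y) = QRe x - QRe y"
| "QI (x - y) = QI x - QI y"
| "QJ (x - y) = QJ x - QJ y"
| "QK (x - y) = QK x - QK y"

instance
  by standard (simp_all add: quat_eq_iff)

end

instantiation quat :: ring_1
begin

primcorec one_quat where
  "QRe 1 = 1" | "QI 1 = 0" | "QJ 1 = 0" | "QK 1 = 0"

primcorec times_quat where
  "QRe (x * y) = QRe x * QRe y - QI x * QI y - QJ x * QJ y - QK x * QK y"
| "QI (x * y) = QRe x * QI y + QI x * QRe y + QJ x * QK y - QK x * QJ y"
| "QJ (x * y) = QRe x * QJ y - QI x * QK y + QJ x * QRe y + QK x * QI y"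
| "QK (x * y) = QRe x * QK y + QI x * QJ y - QJ x * QI y + QK x * QRe y"

instance
  by standard (simp_all add: quat_eq_iff algebra_simps)

end

lemma quat_units:
  defines "i \<equiv> Quat 0 1 0 0" and "j \<equiv> Quat 0 0 1 0" and "k \<equiv> Quat 0 0 0 1"
  shows "i * i = - 1" "j * j = - 1" "k * k = - 1" "i * j * k = - 1"
  by (simp_all add: assms quat_eq_iff)

definition quat_nrm :: "quat \<Rightarrow> real" where
  "quat_nrm x = (QRe x)\<^sup>2 + (QI x)\<^sup>2 + (QJ x)\<^sup>2 + (QK x)\<^sup>2"

lemma quat_nrm_eq_0: "quat_nrm x = 0 \<longleftrightarrow> x = 0"
  by (simp add: quat_nrm_def quat_eq_iff add_nonneg_eq_0_iff conj_assoc)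

instantiation quat :: real_div_algebra
begin

primcorec scaleR_quat where
  "QRe (scaleR r x) = r * QRe x"
| "QI (scaleR r x) = r * QI x"
| "QJ (scaleR r x) = r * QJ x"
| "QK (scaleR r x) = r * QK x"

primcorec inverse_quat where
  "QRe (inverse x) = QRe x / quat_nrm x"
| "QI (inverse x) = - QI x / quat_nrm x"
| "QJ (inverse x) = - QJ x / quat_nrm x"
| "QK (inverse x) = - QK x / quat_nrm x"

definition "x div y = x * inverse y" for x y :: quat

instance
proof
  fix a b :: real and x y :: quat
  show "scaleR a (x + y) = scaleR a x + scaleR a y"
    "scaleR (a + b) x = scaleR a x + scaleR b x"
    "scaleR a (scaleR b x) = scaleR (a * b) x"
    "scaleR 1 x = x"
    "scaleR a x * y = scaleR a (x * y)"
    "x * scaleR a y = scaleR a (x * y)"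
    by (simp_all add: quat_eq_iff algebra_simps)
  show "inverse (0::quat) = 0"
    by (simp add: quat_eq_iff)
  show "x div y = x * inverse y"
    by (rule divide_quat_def)
  assume "x \<noteq> 0"
  then have n: "quat_nrm x \<noteq> 0"
    by (simp add: quat_nrm_eq_0)
  have d: "a / quat_nrm x + b / quat_nrm x = (a + b) / quat_nrm x"
          "a / quat_nrm x - b / quat_nrm x = (a - b) / quat_nrm x" for a b
    by (simp_all add: add_divide_distrib diff_divide_distrib)
  show "inverse x * x = 1" "x * inverse x = 1"
    using n by (simp_all add: quat_eq_iff d)
      (simp_all add: quat_nrm_def power2_eq_square)
qed

end


section \<open>Row dependency ratio\<close>

text \<open>Matrices over \<open>'a\<close> have type \<^typ>\<open>'a^2^2\<close>, where \<^term>\<open>A $ i $ j\<close> is the entry in row \<open>i\<close> and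
  column \<open>j\<close>.\<close>

definition mat22 :: "'a::zero \<Rightarrow> 'a \<Rightarrow> 'a \<Rightarrow> 'a \<Rightarrow> 'a^2^2" where
  "mat22 a b c d = vector [vector [a, b], vector [c, d]]"

lemma mat22_eq_iff:
  "A = mat22 a b c d \<longleftrightarrow> A $ 1 $ 1 = a \<and> A $ 1 $ 2 = b \<and> A $ 2 $ 1 = c \<and> A $ 2 $ 2 = d"
  by (auto simp: mat22_def vec_eq_iff forall_2)

lemma mat22_inject:
  "mat22 a b c d = mat22 a' b' c' d' \<longleftrightarrow> a = a' \<and> b = b' \<and> c = c' \<and> d = d'"
  by (auto simp: mat22_def vec_eq_iff forall_2)

definition first_form :: "'a::division_ring \<Rightarrow> 'a^2^2 \<Rightarrow> bool" where
  "first_form t A \<longleftrightarrow>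
     (\<exists>a1 a2. \<not> (a1 = 0 \<and> a2 = 0) \<and> A = mat22 a1 a2 (t * a1) (t * a2))"

definition second_form :: "'a::division_ring^2^2 \<Rightarrow> bool" where
  "second_form A \<longleftrightarrow>
     (\<exists>a1 a2. \<not> (a1 = 0 \<and> a2 = 0) \<and> A = mat22 0 0 a1 a2)"

datatype 'a ratio = Finite_ratio 'a | Infinite_ratio

text \<open>The value is meaningful only for nonzero non-invertible matrices.\<close>

definition row_ratio :: "'a::division_ring^2^2 \<Rightarrow> 'a ratio" where
  "row_ratio A = (if second_form A then Infinite_ratio else Finite_ratio (THE t. first_form t A))"

lemma first_form_unique: "first_form s A \<Longrightarrow> first_form t A \<Longrightarrow> s = t"
  by (auto simp: first_form_def mat22_eq_iff)

lemma first_form_not_second: "first_form t A \<Longrightarrow> \<not> second_form A"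
  by (auto simp: first_form_def second_form_def mat22_eq_iff)

lemma row_ratio_first: "first_form t A \<Longrightarrow> row_ratio A = Finite_ratio t"
  by (auto simp: row_ratio_def first_form_not_second intro: first_form_unique)

lemma row_ratio_second: "second_form A \<Longrightarrow> row_ratio A = Infinite_ratio"
  by (simp add: row_ratio_def)

lemma mat_eq_mat22: "mat 1 = mat22 1 0 0 (1 :: 'a::semiring_1)"
  by (simp add: mat22_eq_iff mat_def)

lemma mult_mat22:
  "mat22 a b c d ** mat22 a' b' c' d' =
   mat22 (a * a' + b * c') (a * b' + b * d') (c * a' + d * c') (c * b' + d * d')"
  for a :: "'a::semiring_1"
  by (simp add: mat22_def matrix_matrix_mult_def vec_eq_iff forall_2 sum_2)

lemma singular_cases:
  fixes A :: "'a::division_ring^2^2"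
  assumes "A \<noteq> 0" and sing: "\<not> invertible A"
  shows "(\<exists>t. first_form t A) \<or> second_form A"
proof -
  obtain a b c d where A: "A = mat22 a b c d"
    by (simp add: mat22_eq_iff)
  have nz: "\<not> (a = 0 \<and> b = 0 \<and> c = 0 \<and> d = 0)"
    using \<open>A \<noteq> 0\<close> unfolding A by (auto simp: mat22_def vec_eq_iff forall_2)
  have inv: False
    if "A ** mat22 p q r s = mat 1" "mat22 p q r s ** A = mat 1" for p q r s
    using sing that unfolding invertible_def by blast
  consider "a \<noteq> 0" | "a = 0" "b \<noteq> 0" | "a = 0" "b = 0"
    by blast
  then show ?thesis
  proof cases
    case 1
    define t where "t = c * inverse a"
    define e where "e = d - t * b"
    have c: "c = t * a" and d: "d = t * b + e"
      using 1 by (simp_all add: t_def e_def mult.assoc)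
    have "e = 0"
    proof (rule ccontr)
      assume "e \<noteq> 0"
      let ?i = "inverse a" and ?j = "inverse e"
      have a: "a * (?i * x) = x" "?i * (a * x) = x" "e * (?j * x) = x" "?j * (e * x) = x" for x
        using 1 \<open>e \<noteq> 0\<close> by (simp_all flip: mult.assoc)
      show False
        by (rule inv[of "?i + ?i * b * ?j * t" "- (?i * b * ?j)" "- (?j * t)" ?j])
          (use 1 \<open>e \<noteq> 0\<close> in \<open>simp_all add: A mult_mat22 mat_eq_mat22 mat22_inject c d
            algebra_simps a\<close>)
    qed
    then show ?thesis
      using 1 by (auto simp: first_form_def A c d)
  next
    case 2
    define t where "t = d * inverse b"
    have d: "d = t * b"
      using 2 by (simp add: t_def mult.assoc)
    have "c = 0"
    proof (rule ccontr)
      assume "c \<noteq> 0"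
      have b: "b * (inverse b * x) = x" "c * (inverse c * x) = x" for x
        using 2 \<open>c \<noteq> 0\<close> by (simp_all flip: mult.assoc)
      show False
        by (rule inv[of "- (inverse c * t)" "inverse c" "inverse b" 0])
          (use 2 \<open>c \<noteq> 0\<close> in \<open>simp_all add: A mult_mat22 mat_eq_mat22 mat22_inject d
            mult.assoc b\<close>)
    qed
    then show ?thesis
      using 2 unfolding first_form_def A d by (metis mult_zero_right)
  next
    case 3
    then show ?thesis
      using nz by (auto simp: second_form_def A)
  qed
qed


section \<open>The map\<close>

text \<open>The library's power operation on \<^typ>\<open>'a^2^2\<close> is taken entrywise, so powers for the matrix
  product are defined here.\<close>

primrec mat_power :: "'a::semiring_1^'n^'n \<Rightarrow> nat \<Rightarrow> 'a^'n^'n" where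
  "mat_power X 0 = mat 1"
| "mat_power X (Suc k) = X ** mat_power X k"

definition power_map :: "'a::semiring_1^2^2 \<Rightarrow> nat \<Rightarrow> 'a^2^2 \<Rightarrow> 'a^2^2" where
  "power_map A k X = A ** mat_power X k"

end

theory Submission
  imports Defs
begin

text \<open>
  A nonzero singular matrix is a column times a nonzero row \<open>a\<close>, and its row dependency ratio
  records exactly the column: \<open>(1, t)\<close> for the ratio \<open>t\<close>, and \<open>(0, 1)\<close> for the ratio \<open>\<infinity>\<close>. Right
  multiplication changes only the row. So the image of \<open>X \<mapsto> A X\<^sup>k\<close> stays inside the matrices with
  the column of \<open>A\<close>, together with zero, and the theorem says that \<open>X \<mapsto> a X\<^sup>k\<close> maps onto the whole
  row space when \<open>a \<noteq> 0\<close> (\<open>row_power_onto\<close>).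

  Let \<open>m\<close> be a target row. If \<open>a\<close> and \<open>m\<close> are left linearly independent, the linear map with
  \<open>a \<mapsto> m\<close> and \<open>m \<mapsto> m\<close> works for every \<open>k\<close>; no root has to be extracted, and this is true over every
  division ring. Otherwise \<open>m = s a\<close>, and in a basis that starts with \<open>a\<close> the question becomes whether
  some power \<open>Y\<^sup>k\<close> has first row \<open>(s, 0)\<close>. Only here does the ground ring matter. In all three cases
  the answer comes from a complex \<open>k\<close>-th root: over the complex numbers \<open>Y\<close> is that root as a
  diagonal entry; a quaternion lies in a copy of the complex numbers inside the quaternions, so it has
  a root as well; and over the reals \<open>s\<close> may be negative and have no real root, but the complex
  root of \<open>s\<close>, written as a real \<open>2 \<times> 2\<close> matrix, still has \<open>k\<close>-th power \<open>s I\<close>.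
\<close>

section \<open>Singular matrices as a column times a row\<close>

text \<open>The product of the column that belongs to the ratio \<open>\<rho>\<close> and the row \<open>(a\<^sub>1, a\<^sub>2)\<close>.\<close>

fun ratio_mat :: "'a ratio \<Rightarrow> 'a::division_ring \<Rightarrow> 'a \<Rightarrow> 'a^2^2" where
  "ratio_mat (Finite_ratio t) a1 a2 = mat22 a1 a2 (t * a1) (t * a2)"
| "ratio_mat Infinite_ratio a1 a2 = mat22 0 0 a1 a2"

lemma zero_eq_mat22: "(0::'a::zero^2^2) = mat22 0 0 0 0"
  by (simp add: mat22_eq_iff)

lemma ratio_mat_eq_0_iff: "ratio_mat \<rho> a1 a2 = 0 \<longleftrightarrow> a1 = 0 \<and> a2 = 0"
  by (cases \<rho>) (auto simp: zero_eq_mat22 mat22_inject)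

lemma ratio_mat_mult:
  "ratio_mat \<rho> a1 a2 ** mat22 p q r s = ratio_mat \<rho> (a1 * p + a2 * r) (a1 * q + a2 * s)"
  by (cases \<rho>) (simp_all add: mult_mat22 mat22_inject algebra_simps)

lemma row_ratio_ratio_mat:
  assumes "\<not> (a1 = 0 \<and> a2 = 0)"
  shows "row_ratio (ratio_mat \<rho> a1 a2) = \<rho>"
proof (cases \<rho>)
  case (Finite_ratio t)
  have "first_form t (ratio_mat \<rho> a1 a2)"
    unfolding first_form_def Finite_ratio ratio_mat.simps using assms by blast
  then show ?thesis
    by (simp add: row_ratio_first Finite_ratio)
next
  case Infinite_ratio
  have "second_form (ratio_mat \<rho> a1 a2)"
    unfolding second_form_def Infinite_ratio ratio_mat.simps using assms by blast
  then show ?thesis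
    by (simp add: row_ratio_second Infinite_ratio)
qed

text \<open>A nonzero row annihilates the column from the left: \<open>(-t, 1)\<close> for the ratio \<open>t\<close>, and \<open>(1, 0)\<close>
  for the ratio \<open>\<infinity>\<close>. An invertible matrix has no such left annihilator.\<close>

lemma ratio_mat_singular: "\<not> invertible (ratio_mat \<rho> a1 a2)"
proof
  assume "invertible (ratio_mat \<rho> a1 a2)"
  then obtain B where B: "ratio_mat \<rho> a1 a2 ** B = mat 1"
    unfolding invertible_def by blast
  obtain x y where xy: "\<not> (x = 0 \<and> y = 0)" "mat22 x y 0 0 ** ratio_mat \<rho> a1 a2 = 0"
  proof (cases \<rho>)
    case (Finite_ratio t)
    then show thesis
      by (intro that[of "- t" 1]) (simp_all add: mult_mat22 zero_eq_mat22)
  next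
    case Infinite_ratio
    then show thesis
      by (intro that[of 1 0]) (simp_all add: mult_mat22 zero_eq_mat22)
  qed
  have "mat22 x y 0 0 = mat22 x y 0 0 ** (ratio_mat \<rho> a1 a2 ** B)"
    by (simp add: B)
  also have "\<dots> = 0"
    by (simp add: matrix_mul_assoc xy(2))
  finally show False
    using xy(1) by (simp add: zero_eq_mat22 mat22_inject)
qed

lemma singular_eq_ratio_mat:
  fixes A :: "'a::division_ring^2^2"
  assumes "A \<noteq> 0" and "\<not> invertible A"
  obtains a1 a2 where "A = ratio_mat (row_ratio A) a1 a2" and "\<not> (a1 = 0 \<and> a2 = 0)"
proof -
  have "\<exists>\<rho> a1 a2. A = ratio_mat \<rho> a1 a2"
    using singular_cases[OF assms] unfolding first_form_def second_form_def
    by (metis ratio_mat.simps)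
  then obtain \<rho> a1 a2 where A: "A = ratio_mat \<rho> a1 a2"
    by blast
  with \<open>A \<noteq> 0\<close> have nz: "\<not> (a1 = 0 \<and> a2 = 0)"
    by (simp add: ratio_mat_eq_0_iff)
  with A show thesis
    by (intro that) (simp_all add: row_ratio_ratio_mat)
qed

section \<open>Powers that move a given row to a given row\<close>

lemma mat_power_conjugate:
  fixes P Q Y :: "'a::semiring_1^'n^'n"
  assumes PQ: "P ** Q = mat 1" and QP: "Q ** P = mat 1"
  shows "mat_power (Q ** Y ** P) k = Q ** mat_power Y k ** P"
proof (induction k)
  case 0
  show ?case by (simp add: QP)
next
  case (Suc k)
  have "mat_power (Q ** Y ** P) (Suc k) = Q ** Y ** (P ** Q) ** mat_power Y k ** P"
    by (simp only: mat_power.simps Suc matrix_mul_assoc)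
  then show ?case
    by (simp add: PQ matrix_mul_assoc)
qed

lemma mat_power_idempotent:
  assumes "Y ** Y = Y" and "k > 0"
  shows "mat_power Y k = Y"
  using \<open>k > 0\<close>
proof (induction k rule: nat_induct_non_zero)
  case (Suc k)
  then show ?case by (simp add: assms(1))
qed simp

lemma invertible_if_rows_independent:
  fixes a1 a2 :: "'a::division_ring"
  assumes "\<not> (a1 = 0 \<and> a2 = 0)" and "\<And>s. \<not> (b1 = s * a1 \<and> b2 = s * a2)"
  shows "invertible (mat22 a1 a2 b1 b2)"
proof (rule ccontr)
  assume "\<not> invertible (mat22 a1 a2 b1 b2)"
  moreover have "mat22 a1 a2 b1 b2 \<noteq> 0"
    using assms(1) by (auto simp: zero_eq_mat22 mat22_inject)
  ultimately consider t where "first_form t (mat22 a1 a2 b1 b2)" | "second_form (mat22 a1 a2 b1 b2)"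
    using singular_cases by blast
  then show False
    using assms by cases (auto simp: first_form_def second_form_def mat22_inject)
qed

text \<open>Rows are carried as the first row of a matrix whose second row is zero. A conjugation takes the
  basis \<open>a, b\<close> to the standard one, so that the image of \<open>a\<close> under the \<open>k\<close>-th power is read off from
  the first row of \<open>Y\<^sup>k\<close>.\<close>

lemma row_power_in_basis:
  fixes a1 a2 :: "'a::division_ring"
  assumes inv: "invertible (mat22 a1 a2 b1 b2)"
    and Y: "mat_power Y k = mat22 p q r s"
  obtains X where "mat22 a1 a2 0 0 ** mat_power X k = mat22 (p * a1 + q * b1) (p * a2 + q * b2) 0 0"
proof -
  let ?P = "mat22 a1 a2 b1 b2"
  obtain Q where PQ: "?P ** Q = mat 1" and QP: "Q ** ?P = mat 1"
    using inv unfolding invertible_def by blast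
  have "mat22 a1 a2 0 0 = mat22 1 0 0 0 ** ?P"
    by (simp add: mult_mat22)
  then have "mat22 a1 a2 0 0 ** mat_power (Q ** Y ** ?P) k
      = mat22 1 0 0 0 ** (?P ** Q) ** mat_power Y k ** ?P"
    by (simp only: mat_power_conjugate[OF PQ QP] matrix_mul_assoc)
  also have "\<dots> = mat22 (p * a1 + q * b1) (p * a2 + q * b2) 0 0"
    by (simp add: PQ Y mult_mat22)
  finally show thesis
    by (rule that)
qed

lemma row_power_onto:
  fixes a1 a2 m1 m2 :: "'a::division_ring"
  assumes a: "\<not> (a1 = 0 \<and> a2 = 0)" and k: "k > 0"
    and root: "\<And>s::'a. \<exists>Y r t. mat_power Y k = mat22 s 0 r t"
  shows "\<exists>X. mat22 a1 a2 0 0 ** mat_power X k = mat22 m1 m2 0 0"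
proof (cases "\<exists>s. m1 = s * a1 \<and> m2 = s * a2")
  case True
  then obtain s where m: "m1 = s * a1" "m2 = s * a2"
    by blast
  \<comment> \<open>A unit row completes \<open>a\<close> to a basis; which one depends on the nonzero coordinate of \<open>a\<close>.\<close>
  obtain b1 b2 where "invertible (mat22 a1 a2 b1 b2)"
  proof (cases "a1 = 0")
    case True
    then show thesis
      using a by (intro that[of 1 0] invertible_if_rows_independent) auto
  next
    case False
    then show thesis
      by (intro that[of 0 1] invertible_if_rows_independent) auto
  qed
  moreover obtain Y r t where "mat_power Y k = mat22 s 0 r t"
    using root by blast
  ultimately show ?thesis
    by (rule row_power_in_basis) (auto simp: m)
next
  case False
  then have "invertible (mat22 a1 a2 m1 m2)"
    using a by (intro invertible_if_rows_independent) auto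
  \<comment> \<open>In the basis \<open>a, m\<close>, this idempotent sends both basis rows to \<open>m\<close>.\<close>
  moreover have "mat_power (mat22 0 1 0 1) k = mat22 0 1 0 (1::'a)"
    using k by (intro mat_power_idempotent) (simp_all add: mult_mat22)
  ultimately show ?thesis
    by (rule row_power_in_basis) auto
qed

text \<open>The equality holds over every division ring in which the scalar problem can be solved; a
  \<open>2 \<times> 2\<close> matrix with prescribed first row in its \<open>k\<close>-th power replaces a \<open>k\<close>-th root, because negative
  reals have such matrices even when they have no root.\<close>

lemma range_power_map:
  fixes A :: "'a::division_ring^2^2"
  assumes A: "A \<noteq> 0" "\<not> invertible A" and k: "k > 0"
    and root: "\<And>s::'a. \<exists>Y r t. mat_power Y k = mat22 s 0 r t"
  shows "range (power_map A k) =
    {M. \<not> invertible M \<and> M \<noteq> 0 \<and> row_ratio M = row_ratio A} \<union> {0}"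
proof -
  define \<rho> where "\<rho> = row_ratio A"
  obtain a1 a2 where A_eq: "A = ratio_mat \<rho> a1 a2" and a: "\<not> (a1 = 0 \<and> a2 = 0)"
    using singular_eq_ratio_mat[OF A] unfolding \<rho>_def by blast
  show ?thesis
  proof (intro equalityI subsetI)
    fix M assume "M \<in> range (power_map A k)"
    then obtain X where M: "M = A ** mat_power X k"
      by (auto simp: power_map_def)
    obtain p q r s where "mat_power X k = mat22 p q r s"
      by (simp add: mat22_eq_iff)
    then obtain m1 m2 where M_eq: "M = ratio_mat \<rho> m1 m2"
      by (simp add: M A_eq ratio_mat_mult)
    show "M \<in> {M. \<not> invertible M \<and> M \<noteq> 0 \<and> row_ratio M = row_ratio A} \<union> {0}"
      using row_ratio_ratio_mat[of m1 m2 \<rho>] ratio_mat_singular[of \<rho> m1 m2]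
      by (auto simp: M_eq ratio_mat_eq_0_iff simp flip: \<rho>_def)
  next
    fix M assume "M \<in> {M. \<not> invertible M \<and> M \<noteq> 0 \<and> row_ratio M = row_ratio A} \<union> {0}"
    then have "M = 0 \<or> (M \<noteq> 0 \<and> \<not> invertible M \<and> row_ratio M = \<rho>)"
      by (auto simp: \<rho>_def)
    then obtain m1 m2 where M_eq: "M = ratio_mat \<rho> m1 m2"
    proof (elim disjE conjE)
      assume "M = 0"
      then show thesis
        by (intro that[of 0 0]) (simp add: ratio_mat_eq_0_iff eq_commute[of 0])
    next
      assume "M \<noteq> 0" "\<not> invertible M" "row_ratio M = \<rho>"
      then show thesis
        using that by (metis singular_eq_ratio_mat)
    qed
    obtain X where X: "mat22 a1 a2 0 0 ** mat_power X k = mat22 m1 m2 0 0"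
      using row_power_onto[OF a k root] by blast
    obtain p q r s where pq: "mat_power X k = mat22 p q r s"
      by (simp add: mat22_eq_iff)
    have "power_map A k X = M"
      using X by (simp add: power_map_def A_eq M_eq pq ratio_mat_mult mult_mat22 mat22_inject)
    then show "M \<in> range (power_map A k)"
      by blast
  qed
qed

section \<open>Extracting roots\<close>

lemma scalar_root_imp_matrix_root:
  fixes s :: "'a::semiring_1"
  assumes "z ^ k = s"
  shows "\<exists>Y r t. mat_power Y k = mat22 s 0 r t"
proof -
  have "mat_power (mat22 z 0 0 1) k = mat22 (z ^ k) 0 0 1"
    by (induction k) (simp_all add: mat_eq_mat22 mult_mat22)
  then show ?thesis
    using assms by blast
qed

text \<open>The matrix of multiplication by \<open>z\<close> on the real plane, acting on rows.\<close>

definition plane_mat :: "complex \<Rightarrow> real^2^2" where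
  "plane_mat z = mat22 (Re z) (Im z) (- Im z) (Re z)"

lemma plane_mat_power: "mat_power (plane_mat z) k = plane_mat (z ^ k)"
  by (induction k) (simp_all add: plane_mat_def mat_eq_mat22 mult_mat22 mat22_inject algebra_simps)

lemma real_matrix_root:
  fixes s :: real
  assumes "k > 0"
  shows "\<exists>Y r t. mat_power Y k = mat22 s 0 r t"
proof -
  have "k \<noteq> 0"
    using assms by simp
  then obtain z where z: "complex_of_real s = z ^ k"
    by (rule exists_complex_root)
  have "mat_power (plane_mat z) k = plane_mat (of_real s)"
    by (simp only: plane_mat_power z)
  also have "\<dots> = mat22 s 0 0 s"
    by (simp add: plane_mat_def)
  finally show ?thesis
    by blast
qed

text \<open>The embedding of the complex numbers into an algebra that sends \<open>\<i>\<close> to \<open>u\<close>; it is multiplicative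
  as soon as \<open>u\<^sup>2 = -1\<close>.\<close>

definition complex_embed :: "'a::real_algebra_1 \<Rightarrow> complex \<Rightarrow> 'a" where
  "complex_embed u z = scaleR (Re z) 1 + scaleR (Im z) u"

lemma complex_embed_power:
  assumes "u * u = - 1"
  shows "complex_embed u (z ^ k) = complex_embed u z ^ k"
proof (induction k)
  case (Suc k)
  have "complex_embed u (z * w) = complex_embed u z * complex_embed u w" for w
    using assms by (simp add: complex_embed_def algebra_simps)
  then show ?case
    by (simp add: Suc)
qed (simp add: complex_embed_def)

text \<open>The normalised imaginary part of \<open>s\<close> is a square root of \<open>-1\<close>. For real \<open>s\<close> any square root
  of \<open>-1\<close> will do.\<close>

lemma quat_in_complex_plane:
  fixes s :: quat
  obtains u z where "u * u = - 1" and "s = complex_embed u z"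
proof -
  define n where "n = sqrt ((QI s)\<^sup>2 + (QJ s)\<^sup>2 + (QK s)\<^sup>2)"
  have n2: "n * n = QI s * QI s + QJ s * QJ s + QK s * QK s"
    by (simp add: n_def power2_eq_square)
  show thesis
  proof (cases "n = 0")
    case True
    then have "QI s = 0" "QJ s = 0" "QK s = 0"
      by (simp_all add: n_def add_nonneg_eq_0_iff)
    then show thesis
      by (intro that[of "Quat 0 1 0 0" "of_real (QRe s)"])
        (simp_all add: complex_embed_def quat_eq_iff)
  next
    case False
    define u where "u = Quat 0 (QI s / n) (QJ s / n) (QK s / n)"
    have "QI s * QI s / (n * n) + QJ s * QJ s / (n * n) + QK s * QK s / (n * n) = 1"
      using False by (simp flip: add_divide_distrib n2)
    then have "u * u = - 1"
      by (simp add: u_def quat_eq_iff)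
    then show thesis
      using False by (intro that[of u "Complex (QRe s) n"])
        (simp_all add: u_def complex_embed_def quat_eq_iff)
  qed
qed

lemma quat_root:
  fixes s :: quat
  assumes "k > 0"
  shows "\<exists>z. z ^ k = s"
proof -
  obtain u w where u: "u * u = - 1" and s: "s = complex_embed u w"
    by (rule quat_in_complex_plane)
  have "k \<noteq> 0"
    using assms by simp
  then obtain z where "w = z ^ k"
    by (rule exists_complex_root)
  then have "complex_embed u z ^ k = s"
    by (simp only: s complex_embed_power[OF u])
  then show ?thesis
    by blast
qed

section \<open>The image of the power map\<close>

theorem theorem1p3:
  shows
   "(\<forall>(A :: real^2^2) (k :: nat). A \<noteq> 0 \<and> \<not> invertible A \<and> k > 0 \<longrightarrow>
       range (power_map A k) =
         {M. \<not> invertible M \<and> M \<noteq> 0 \<and> row_ratio M = row_ratio A} \<union> {0}) \<and>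
    (\<forall>(A :: complex^2^2) (k :: nat). A \<noteq> 0 \<and> \<not> invertible A \<and> k > 0 \<longrightarrow>
       range (power_map A k) =
         {M. \<not> invertible M \<and> M \<noteq> 0 \<and> row_ratio M = row_ratio A} \<union> {0}) \<and>
    (\<forall>(A :: quat^2^2) (k :: nat). A \<noteq> 0 \<and> \<not> invertible A \<and> k > 0 \<longrightarrow>
       range (power_map A k) =
         {M. \<not> invertible M \<and> M \<noteq> 0 \<and> row_ratio M = row_ratio A} \<union> {0})"
proof (intro conjI allI impI; elim conjE)
  fix A :: "real^2^2" and k :: nat
  assume "A \<noteq> 0" "\<not> invertible A" "k > 0"
  then show "range (power_map A k) =
      {M. \<not> invertible M \<and> M \<noteq> 0 \<and> row_ratio M = row_ratio A} \<union> {0}"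
    by (intro range_power_map real_matrix_root)
next
  fix A :: "complex^2^2" and k :: nat
  assume "A \<noteq> 0" "\<not> invertible A" "k > 0"
  moreover have "\<exists>Y r t. mat_power Y k = mat22 s 0 r t" for s :: complex
  proof -
    have "k \<noteq> 0"
      using \<open>k > 0\<close> by simp
    then obtain z where "s = z ^ k"
      by (rule exists_complex_root)
    then show ?thesis
      by (intro scalar_root_imp_matrix_root) (rule sym)
  qed
  ultimately show "range (power_map A k) =
      {M. \<not> invertible M \<and> M \<noteq> 0 \<and> row_ratio M = row_ratio A} \<union> {0}"
    by (rule range_power_map)
next
  fix A :: "quat^2^2" and k :: nat
  assume "A \<noteq> 0" "\<not> invertible A" "k > 0"
  moreover have "\<exists>Y r t. mat_power Y k = mat22 s 0 r t" for s :: quat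
    using quat_root[OF \<open>k > 0\<close>, of s] scalar_root_imp_matrix_root by blast
  ultimately show "range (power_map A k) =
      {M. \<not> invertible M \<and> M \<noteq> 0 \<and> row_ratio M = row_ratio A} \<union> {0}"
    by (rule range_power_map)
qed

end
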